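(* Let $K$ be a field, $G$ a finite group and $\mathcal{C}\leq KG$ a $G$-code with $\mathcal{C}\neq\{0\}$. If $\mathcal{C}=\mathcal{C}*\mathcal{C}$, then there exists a subgroup $H\leq G$ such that $\mathcal{C}=K_H^G$. In particular, $d(\mathcal{C})\cdot\dim\mathcal{C}=|G|$.
   Context: $KG$ is the group algebra of $G$ over $K$. A $G$-code over $K$ is a right ideal $\mathcal{C}$ of $KG$ (written $\mathcal{C}\leq KG$); $\dim\mathcal{C}$ is its dimension over $K$. For $f=\sum_{g\in G}a_g g\in KG$ the weight is $\mathrm{wt}(f)=|\{g\in G\mid a_g\neq 0\}|$, and $d(\mathcal{C})=\min\{\mathrm{wt}(c)\mid c\in\mathcal{C},\ c\neq 0\}$. The Schur product on $KG$ is the componentwise product $\left(\sum_{g}a_g g\right)*\left(\sum_g b_g g\right)=\sum_g a_gb_g\, g$, and for $G$-codes $\mathcal{C},\mathcal{C}'$, $\mathcal{C}*\mathcal{C}'$ is the $K$-linear span of $\{c*c'\mid c\in\mathcal{C},c'\in\mathcal{C}'\}$. For $H\leq G$, $K_H^G$ denotes the $KG$-module induced from the trivial $KH$-module $K_H$, identified with the right ideal $\left(\sum_{h\in H}h\right)KG=\bigoplus_{i=1}^s K\left(\sum_{h\in H}hg_i\right)$ of $KG$, where $\{g_1,\dots,g_s\}$ is a right transversal of $H$ in $G$ (so that $G$ is the disjoint union of the cosets $Hg_i$). *)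

theory Defs
  imports
    Complex_Main
    "HOL-Algebra.Coset"
    "HOL-Algebra.Ideal"
    "HOL-Library.Function_Algebras"
begin

(* The group G is an HOL-Algebra group; the field K is a type 'k of class field.
   An element of KG, a formal sum of a_g g, is its coefficient function, set to 0 outside the
   carrier of G, so that equality in KG is equality of functions. The sum of two functions and
   the zero function are those of HOL-Library.Function_Algebras (pointwise). *)

definition group_algebra :: "('g, 'm) monoid_scheme \<Rightarrow> ('g \<Rightarrow> 'k::field) ring" where
  "group_algebra G =
     \<lparr>carrier = {f. \<forall>x. x \<notin> carrier G \<longrightarrow> f x = 0},
      mult = (\<lambda>f h x. if x \<in> carrier G
                then \<Sum>y\<in>carrier G. f y * h (inv\<^bsub>G\<^esub> y \<otimes>\<^bsub>G\<^esub> x) else 0),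
      one = (\<lambda>x. if x = \<one>\<^bsub>G\<^esub> then 1 else 0),
      zero = 0,
      add = (+)\<rparr>"

definition ga_elem :: "'g \<Rightarrow> 'g \<Rightarrow> 'k::field" where
  "ga_elem g = (\<lambda>x. if x = g then 1 else 0)"

definition ga_scale :: "'k \<Rightarrow> ('g \<Rightarrow> 'k) \<Rightarrow> 'g \<Rightarrow> 'k::field" where
  "ga_scale a f = (\<lambda>x. a * f x)"

lemma vector_space_ga_scale: "Vector_Spaces.vector_space ga_scale"
  by unfold_locales (auto simp: ga_scale_def fun_eq_iff algebra_simps)

(* HOL-Algebra only has two-sided ideals; this is its ideal with closure on the left dropped. *)
definition right_ideal :: "'a set \<Rightarrow> ('a, 'b) ring_scheme \<Rightarrow> bool" where
  "right_ideal I R \<longleftrightarrow> ring R \<and> additive_subgroup I R \<and>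
     (\<forall>a\<in>I. \<forall>x\<in>carrier R. a \<otimes>\<^bsub>R\<^esub> x \<in> I)"

definition group_code :: "('g, 'm) monoid_scheme \<Rightarrow> ('g \<Rightarrow> 'k::field) set \<Rightarrow> bool" where
  "group_code G C \<longleftrightarrow> right_ideal C (group_algebra G)"

definition code_dim :: "('g \<Rightarrow> 'k::field) set \<Rightarrow> nat" where
  "code_dim C = Vector_Spaces.vector_space.dim ga_scale C"

definition wt :: "('g, 'm) monoid_scheme \<Rightarrow> ('g \<Rightarrow> 'k::field) \<Rightarrow> nat" where
  "wt G f = card {g \<in> carrier G. f g \<noteq> 0}"

(* Meaningful only if C contains a nonzero element (Min of the empty set is unspecified). *)
definition min_dist :: "('g, 'm) monoid_scheme \<Rightarrow> ('g \<Rightarrow> 'k::field) set \<Rightarrow> nat" where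
  "min_dist G C = Min {wt G c | c. c \<in> C \<and> c \<noteq> 0}"

definition schur :: "('g \<Rightarrow> 'k) \<Rightarrow> ('g \<Rightarrow> 'k) \<Rightarrow> 'g \<Rightarrow> 'k::field" where
  "schur f h = (\<lambda>x. f x * h x)"

definition schur_code :: "('g \<Rightarrow> 'k::field) set \<Rightarrow> ('g \<Rightarrow> 'k) set \<Rightarrow> ('g \<Rightarrow> 'k) set" where
  "schur_code C D = Modules.module.span ga_scale {schur c d | c d. c \<in> C \<and> d \<in> D}"

(* The module induced from the trivial KH-module, as the right ideal (sum of H) KG. *)
definition induced_trivial ::
    "('g, 'm) monoid_scheme \<Rightarrow> 'g set \<Rightarrow> ('g \<Rightarrow> 'k::field) set" where
  "induced_trivial G H =
     {(\<Sum>h\<in>H. ga_elem h) \<otimes>\<^bsub>group_algebra G\<^esub> f | f. f \<in> carrier (group_algebra G)}"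

lemma ring_group_algebra:
  fixes G (structure)
  assumes "group G" and fin: "finite (carrier G)"
  shows "ring (group_algebra G :: ('g \<Rightarrow> 'k::field) ring)"
proof -
  interpret group G by fact
  let ?R = "group_algebra G :: ('g \<Rightarrow> 'k::field) ring"
  have distr: "(a \<oplus>\<^bsub>?R\<^esub> b) \<otimes>\<^bsub>?R\<^esub> c = a \<otimes>\<^bsub>?R\<^esub> c \<oplus>\<^bsub>?R\<^esub> b \<otimes>\<^bsub>?R\<^esub> c"
    "c \<otimes>\<^bsub>?R\<^esub> (a \<oplus>\<^bsub>?R\<^esub> b) = c \<otimes>\<^bsub>?R\<^esub> a \<oplus>\<^bsub>?R\<^esub> c \<otimes>\<^bsub>?R\<^esub> b" for a b c
    by (auto simp: group_algebra_def fun_eq_iff algebra_simps sum.distrib)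
  have one_l: "\<one>\<^bsub>?R\<^esub> \<otimes>\<^bsub>?R\<^esub> f = f" if "f \<in> carrier ?R" for f
  proof (rule ext)
    fix x
    have "(\<Sum>y\<in>carrier G. (if y = \<one> then 1 else 0) * f (inv y \<otimes> x))
        = (\<Sum>y\<in>carrier G. if y = \<one> then f (inv y \<otimes> x) else 0)"
      by (rule sum.cong) auto
    then show "(\<one>\<^bsub>?R\<^esub> \<otimes>\<^bsub>?R\<^esub> f) x = f x"
      using that fin by (auto simp: group_algebra_def)
  qed
  have one_r: "f \<otimes>\<^bsub>?R\<^esub> \<one>\<^bsub>?R\<^esub> = f" if "f \<in> carrier ?R" for f
  proof (rule ext)
    fix x
    have "(\<Sum>y\<in>carrier G. f y * (if inv y \<otimes> x = \<one> then 1 else 0))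
        = (\<Sum>y\<in>carrier G. if y = x then f y else 0)" if "x \<in> carrier G"
      using that by (intro sum.cong) (auto simp: inv_solve_left' l_inv)
    then show "(f \<otimes>\<^bsub>?R\<^esub> \<one>\<^bsub>?R\<^esub>) x = f x"
      using that fin by (auto simp: group_algebra_def)
  qed
  have assoc: "f \<otimes>\<^bsub>?R\<^esub> g \<otimes>\<^bsub>?R\<^esub> h = f \<otimes>\<^bsub>?R\<^esub> (g \<otimes>\<^bsub>?R\<^esub> h)" for f g h
  proof (rule ext)
    fix x
    show "(f \<otimes>\<^bsub>?R\<^esub> g \<otimes>\<^bsub>?R\<^esub> h) x = (f \<otimes>\<^bsub>?R\<^esub> (g \<otimes>\<^bsub>?R\<^esub> h)) x"
    proof (cases "x \<in> carrier G")
      case True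
      have shift: "(\<Sum>y\<in>carrier G. g (inv z \<otimes> y) * h (inv y \<otimes> x))
          = (\<Sum>y\<in>carrier G. g y * h (inv y \<otimes> (inv z \<otimes> x)))" if z: "z \<in> carrier G" for z
      proof -
        have eq1: "inv (inv z \<otimes> y) \<otimes> (inv z \<otimes> x) = inv y \<otimes> x" if "y \<in> carrier G" for y
        proof -
          have "z \<otimes> (inv z \<otimes> x) = x"
            using z True by (simp add: m_assoc[symmetric])
          then show ?thesis
            using that z True by (simp add: inv_mult_group m_assoc)
        qed
        have eq2: "inv z \<otimes> (z \<otimes> y) = y" "z \<otimes> (inv z \<otimes> y) = y" if "y \<in> carrier G" for y
          using that z by (simp_all add: m_assoc[symmetric])
        show ?thesis
          by (rule sum.reindex_bij_witness[where i = "\<lambda>y. z \<otimes> y" and j = "\<lambda>y. inv z \<otimes> y"])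
             (use z in \<open>simp_all add: eq1 eq2\<close>)
      qed
      have "(f \<otimes>\<^bsub>?R\<^esub> g \<otimes>\<^bsub>?R\<^esub> h) x
          = (\<Sum>y\<in>carrier G. \<Sum>z\<in>carrier G. f z * (g (inv z \<otimes> y) * h (inv y \<otimes> x)))"
        using True by (simp add: group_algebra_def sum_distrib_right mult.assoc)
      also have "\<dots> = (\<Sum>z\<in>carrier G. f z * (\<Sum>y\<in>carrier G. g (inv z \<otimes> y) * h (inv y \<otimes> x)))"
        by (subst sum.swap) (simp add: sum_distrib_left)
      also have "\<dots> = (f \<otimes>\<^bsub>?R\<^esub> (g \<otimes>\<^bsub>?R\<^esub> h)) x"
        using True by (simp add: group_algebra_def shift)
      finally show ?thesis .
    qed (simp add: group_algebra_def)
  qed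
  show ?thesis
  proof (rule ringI)
    show "abelian_group ?R"
    proof (rule abelian_groupI)
      fix f assume "f \<in> carrier ?R"
      then show "\<exists>y\<in>carrier ?R. y \<oplus>\<^bsub>?R\<^esub> f = \<zero>\<^bsub>?R\<^esub>"
        by (intro bexI[of _ "- f"]) (auto simp: group_algebra_def)
    qed (auto simp: group_algebra_def algebra_simps)
    show "monoid ?R"
      by (rule monoidI) (use one_l one_r assoc in \<open>auto simp: group_algebra_def\<close>)
  qed (rule distr)+
qed

end

theory Submission
  imports Defs "HOL-Library.Indicator_Function" "HOL-Library.Disjoint_Sets"
begin

text \<open>
  Let \<open>c\<close> be a nonzero codeword of minimal weight, translated and scaled so that
  \<open>c \<one> = 1\<close>. For every codeword \<open>f\<close> the codeword \<open>f * c - f(\<one>) c\<close> is supported in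
  \<open>supp c\<close> minus the point \<open>\<one>\<close>, so it vanishes: every codeword is constant on \<open>supp c\<close>.
  Conversely \<open>supp c\<close> contains every point where all codewords take the value they take at
  \<open>\<one>\<close>, and by right translation these points form the group \<open>H\<close> of left periods of
  the code. Hence \<open>c\<close> is the indicator of \<open>H\<close>, and the code consists exactly of the
  functions that are constant on the cosets \<open>Hg\<close>.
\<close>

section \<open>Dimension of spaces of functions constant on blocks\<close>

lemma sum_fun_apply: "(\<Sum>i\<in>I. f i) x = (\<Sum>i\<in>I. f i x)"
  by (induction I rule: infinite_finite_induct) auto

text \<open>The indicators of the blocks form a basis. As the blocks are disjoint and nonempty,
  evaluating a linear combination at a point of a block reads off its coefficient there; this gives
  independence as well as spanning.\<close>

lemma code_dim_block_functions:
  fixes R :: "'g set set"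
  assumes fin: "finite R" and disj: "disjoint R" and ne: "{} \<notin> R"
  shows "code_dim {f :: 'g \<Rightarrow> 'k::field.
           (\<forall>x. x \<notin> \<Union>R \<longrightarrow> f x = 0) \<and> (\<forall>A\<in>R. \<forall>x\<in>A. \<forall>y\<in>A. f x = f y)} = card R"
    (is "code_dim ?V = _")
proof -
  interpret vector_space "ga_scale :: 'k \<Rightarrow> ('g \<Rightarrow> 'k) \<Rightarrow> 'g \<Rightarrow> 'k"
    by (rule vector_space_ga_scale)
  let ?ind = "indicator :: 'g set \<Rightarrow> 'g \<Rightarrow> 'k"
  let ?B = "?ind ` R"
  have inj: "inj_on ?ind R"
    by (rule inj_onI) (metis indicator_eq_1_iff subsetI subset_antisym)
  have eval: "(\<Sum>A\<in>R. ga_scale (a A) (?ind A)) x = a A" if "A \<in> R" "x \<in> A" for a A x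
  proof -
    have "x \<notin> A'" if "A' \<in> R" "A' \<noteq> A" for A'
      using disj that \<open>A \<in> R\<close> \<open>x \<in> A\<close> by (auto dest: disjointD)
    then have "(\<Sum>A'\<in>R. a A' * ?ind A' x) = (\<Sum>A'\<in>R. if A' = A then a A' else 0)"
      using that by (intro sum.cong) auto
    then show ?thesis
      using that fin by (simp add: sum_fun_apply ga_scale_def)
  qed
  have eval_out: "(\<Sum>A\<in>R. ga_scale (a A) (?ind A)) x = 0" if "x \<notin> \<Union>R" for a x
    using that by (auto simp: sum_fun_apply ga_scale_def intro!: sum.neutral)
  have "independent ?B"
  proof
    assume "dependent ?B"
    then obtain u A where A: "A \<in> R" "u (?ind A) \<noteq> 0"
      and "(\<Sum>v\<in>?B. ga_scale (u v) v) = 0"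
      using fin by (auto simp: dependent_finite)
    then have "(\<Sum>A\<in>R. ga_scale (u (?ind A)) (?ind A)) = 0"
      by (simp add: sum.reindex[OF inj])
    moreover obtain x where "x \<in> A"
      using A ne by fastforce
    ultimately show False
      using eval[of A x "\<lambda>A. u (?ind A)"] A by simp
  qed
  moreover have "?B \<subseteq> ?V"
  proof -
    have "?ind A x = ?ind A y" if "A \<in> R" "A' \<in> R" "x \<in> A'" "y \<in> A'" for A A' x y
      using disj that by (cases "A = A'") (auto simp: indicator_def dest: disjointD)
    moreover have "?ind A x = 0" if "A \<in> R" "x \<notin> \<Union>R" for A x
      using that by (auto simp: indicator_def)
    ultimately show ?thesis by blast
  qed
  moreover have "?V \<subseteq> span ?B"
  proof
    fix f assume f: "f \<in> ?V"
    \<comment> \<open>The chosen point of \<open>A\<close> is immaterial because \<open>f\<close> is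
      constant on \<open>A\<close>.\<close>
    have expand: "f = (\<Sum>A\<in>R. ga_scale (f (SOME y. y \<in> A)) (?ind A))"
    proof
      fix x
      show "f x = (\<Sum>A\<in>R. ga_scale (f (SOME y. y \<in> A)) (?ind A)) x"
      proof (cases "x \<in> \<Union>R")
        case True
        then obtain A where "A \<in> R" "x \<in> A" by blast
        moreover from this have "f x = f (SOME y. y \<in> A)"
          using f someI[of "\<lambda>y. y \<in> A" x] by blast
        ultimately show ?thesis by (simp only: eval)
      next
        case False
        moreover from this have "f x = 0" using f by blast
        ultimately show ?thesis by (simp only: eval_out not_False_eq_True)
      qed
    qed
    show "f \<in> span ?B"
      by (subst expand) (intro span_sum span_scale span_base imageI)
  qed
  ultimately show ?thesis
    unfolding code_dim_def by (intro dim_unique[of ?B] card_image inj)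
qed

section \<open>Products with group elements and with the sum over a subgroup\<close>

lemma group_algebra_mult_ga_elem:
  fixes G (structure) and f :: "'g \<Rightarrow> 'k::field"
  assumes "group G" and fin: "finite (carrier G)" and g: "g \<in> carrier G"
  shows "f \<otimes>\<^bsub>group_algebra G\<^esub> ga_elem g = (\<lambda>x. if x \<in> carrier G then f (x \<otimes> inv g) else 0)"
proof
  fix x
  interpret group G by fact
  have "(\<Sum>y\<in>carrier G. f y * ga_elem g (inv y \<otimes> x))
      = (\<Sum>y\<in>carrier G. if y = x \<otimes> inv g then f y else 0)" if "x \<in> carrier G"
    using that g by (intro sum.cong) (auto simp: ga_elem_def inv_solve_left' inv_solve_right' m_assoc)
  then show "(f \<otimes>\<^bsub>group_algebra G\<^esub> ga_elem g) x = (if x \<in> carrier G then f (x \<otimes> inv g) else 0)"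
    using g fin by (simp add: group_algebra_def)
qed

text \<open>A right ideal is stable under multiplication by \<open>ga_elem (inv g)\<close>, which
  shifts arguments by \<open>g\<close> on the right. The default 0 keeps the result in the group
  algebra.\<close>

lemma group_code_translate:
  fixes G (structure) and C :: "('g \<Rightarrow> 'k::field) set"
  assumes "group G" and "finite (carrier G)" and code: "group_code G C"
    and f: "f \<in> C" and g: "g \<in> carrier G"
  shows "(\<lambda>x. if x \<in> carrier G then f (x \<otimes> g) else 0) \<in> C"
proof -
  interpret group G by fact
  have "ga_elem (inv g) \<in> carrier (group_algebra G :: ('g \<Rightarrow> 'k) ring)"
    using g by (auto simp: group_algebra_def ga_elem_def)
  then have "f \<otimes>\<^bsub>group_algebra G\<^esub> ga_elem (inv g) \<in> C"
    using code f unfolding group_code_def right_ideal_def by blast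
  then show ?thesis
    using assms by (simp add: group_algebra_mult_ga_elem cong: if_cong)
qed

lemma group_algebra_subgroup_sum_mult:
  fixes G (structure) and f :: "'g \<Rightarrow> 'k::field"
  assumes "group G" and fin: "finite (carrier G)" and H: "subgroup H G"
  shows "(\<Sum>h\<in>H. ga_elem h) \<otimes>\<^bsub>group_algebra G\<^esub> f
       = (\<lambda>x. if x \<in> carrier G then \<Sum>y\<in>H #> x. f y else 0)"
proof
  fix x
  interpret group G by fact
  interpret H: subgroup H G by fact
  have finH: "finite H"
    using fin H.subset by (rule finite_subset[rotated])
  have sum_H: "(\<Sum>h\<in>H. ga_elem h) y = (if y \<in> H then 1 else 0 :: 'k)" for y
    using finH by (simp add: sum_fun_apply ga_elem_def)
  have "(\<Sum>y\<in>carrier G. (\<Sum>h\<in>H. ga_elem h) y * f (inv y \<otimes> x))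
      = (\<Sum>y\<in>H #> x. f y)" if x: "x \<in> carrier G"
  proof -
    have "(\<Sum>y\<in>carrier G. (\<Sum>h\<in>H. ga_elem h) y * f (inv y \<otimes> x))
        = (\<Sum>y\<in>H. f (inv y \<otimes> x))"
      unfolding sum_H using fin H.subset by (intro sum.mono_neutral_cong_right) auto
    \<comment> \<open>Inversion permutes \<open>H\<close>.\<close>
    also have "\<dots> = (\<Sum>y\<in>H. f (y \<otimes> x))"
      by (rule sum.reindex_bij_witness[where i = "m_inv G" and j = "m_inv G"]) auto
    also have "\<dots> = (\<Sum>y\<in>H #> x. f y)"
    proof -
      have "H #> x = (\<lambda>y. y \<otimes> x) ` H" by (auto simp: r_coset_def)
      moreover have "inj_on (\<lambda>y. y \<otimes> x) H"
        using x by (auto intro!: inj_onI)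
      ultimately show ?thesis by (simp add: sum.reindex)
    qed
    finally show ?thesis .
  qed
  then show "((\<Sum>h\<in>H. ga_elem h) \<otimes>\<^bsub>group_algebra G\<^esub> f) x
      = (if x \<in> carrier G then \<Sum>y\<in>H #> x. f y else 0)"
    by (simp add: group_algebra_def)
qed

section \<open>The induced trivial module as a space of periodic functions\<close>

text \<open>This pointwise description serves both the dimension count and the comparison with
  \<open>C\<close>. Products with the sum over \<open>H\<close> are periodic because
  \<open>x\<close> enters only through its coset.\<close>

lemma induced_trivial_eq_periodic:
  fixes G (structure)
  assumes "group G" and fin: "finite (carrier G)" and H: "subgroup H G"
  shows "(induced_trivial G H :: ('g \<Rightarrow> 'k::field) set)
       = {f. (\<forall>x. x \<notin> carrier G \<longrightarrow> f x = 0) \<and> (\<forall>h\<in>H. \<forall>x\<in>carrier G. f (h \<otimes> x) = f x)}"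
    (is "_ = ?P")
proof
  interpret group G by fact
  interpret H: subgroup H G by fact
  have coset: "H #> (h \<otimes> x) = H #> x" if "h \<in> H" "x \<in> carrier G" for h x
    using that H by (metis H.mem_carrier coset_join2 coset_mult_assoc H.subset)
  show "induced_trivial G H \<subseteq> ?P"
    by (auto simp: induced_trivial_def group_algebra_subgroup_sum_mult[OF assms] coset)
  show "?P \<subseteq> induced_trivial G H"
  proof
    fix f :: "'g \<Rightarrow> 'k" assume f: "f \<in> ?P"
    (* Averaging over H is not available, as card H may vanish in the field;
       restrict f to a transversal instead. *)
    define r where "r x = (SOME y. y \<in> H #> x)" for x
    define f' where "f' y = (if y \<in> carrier G \<and> r y = y then f y else 0)" for y
    have "(\<Sum>y\<in>H #> x. f' y) = f x" if x: "x \<in> carrier G" for x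
    proof -
      have rx: "r x \<in> H #> x"
        unfolding r_def using rcos_self[OF x H] by (rule someI)
      have sub: "H #> x \<subseteq> carrier G"
        using x by (simp add: r_coset_subset_G H.subset)
      \<comment> \<open>\<open>r\<close> sees only the coset of its argument, so \<open>f'\<close>
        keeps at most one nonzero value per coset.\<close>
      have "r y = r x" if "y \<in> H #> x" for y
      proof -
        from that obtain h where "h \<in> H" "y = h \<otimes> x" by (auto simp: r_coset_def)
        then show ?thesis using coset x by (simp add: r_def)
      qed
      then have "(\<Sum>y\<in>H #> x. f' y) = (\<Sum>y\<in>H #> x. if y = r x then f y else 0)"
        using sub unfolding f'_def by (intro sum.cong) auto
      also have "\<dots> = f (r x)"
        using rx fin sub by (simp add: finite_subset)
      also have "\<dots> = f x"
        using rx f x by (auto simp: r_coset_def)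
      finally show ?thesis .
    qed
    then have "f = (\<Sum>h\<in>H. ga_elem h) \<otimes>\<^bsub>group_algebra G\<^esub> f'"
      using f by (auto simp: group_algebra_subgroup_sum_mult[OF assms])
    moreover have "f' \<in> carrier (group_algebra G)"
      by (simp add: group_algebra_def f'_def)
    ultimately show "f \<in> induced_trivial G H"
      unfolding induced_trivial_def by blast
  qed
qed

text \<open>Left periodicity under \<open>H\<close> is constancy on right cosets, and these
  partition the group, so they serve as the blocks.\<close>

lemma code_dim_induced_trivial:
  fixes G (structure)
  assumes "group G" and fin: "finite (carrier G)" and H: "subgroup H G"
  shows "code_dim (induced_trivial G H :: ('g \<Rightarrow> 'k::field) set) = card (rcosets H)"
proof -
  interpret group G by fact
  interpret H: subgroup H G by fact
  have U: "\<Union>(rcosets H) = carrier G"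
    by (rule rcosets_part_G[OF H])
  have "(\<forall>h\<in>H. \<forall>x\<in>carrier G. f (h \<otimes> x) = f x)
      \<longleftrightarrow> (\<forall>A\<in>rcosets H. \<forall>x\<in>A. \<forall>y\<in>A. f x = f y)" (is "?l \<longleftrightarrow> ?r") for f :: "'g \<Rightarrow> 'k"
  proof
    assume ?l then show ?r by (auto simp: RCOSETS_def r_coset_def)
  next
    assume r: ?r
    show ?l
    proof (intro ballI)
      fix h x assume hx: "h \<in> H" "x \<in> carrier G"
      then have "h \<otimes> x \<in> H #> x" "x \<in> H #> x" "H #> x \<in> rcosets H"
        using rcos_self[OF _ H] rcosetsI[OF H.subset] by (auto simp: r_coset_def)
      then show "f (h \<otimes> x) = f x" using r by blast
    qed
  qed
  then have "(induced_trivial G H :: ('g \<Rightarrow> 'k) set)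
      = {f. (\<forall>x. x \<notin> \<Union>(rcosets H) \<longrightarrow> f x = 0) \<and> (\<forall>A\<in>rcosets H. \<forall>x\<in>A. \<forall>y\<in>A. f x = f y)}"
    by (simp add: induced_trivial_eq_periodic[OF assms] U)
  moreover have "finite (rcosets H)"
    using fin U by (simp add: finite_UnionD)
  moreover have "disjoint (rcosets H)"
    using rcos_disjoint[OF H] by (simp add: disjoint_def pairwise_def disjnt_def)
  moreover have "{} \<notin> rcosets H"
    using H.subgroup_axioms rcos_self by (fastforce simp: RCOSETS_def)
  ultimately show ?thesis
    by (simp only: code_dim_block_functions not_False_eq_True)
qed

section \<open>Codes that equal their Schur square\<close>

theorem theorem3p5:
  fixes G :: "('g, 'm) monoid_scheme"
    and C :: "('g \<Rightarrow> 'k::field) set"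
  assumes "group G"
    and "finite (carrier G)"
    and "group_code G C"
    and "C \<noteq> {0}"
    and "C = schur_code C C"
  shows "(\<exists>H. subgroup H G \<and> C = induced_trivial G H) \<and>
         min_dist G C * code_dim C = order G"
proof -
  note fin = \<open>finite (carrier G)\<close>
  interpret group G by fact
  interpret vector_space "ga_scale :: 'k \<Rightarrow> ('g \<Rightarrow> 'k) \<Rightarrow> 'g \<Rightarrow> 'k"
    by (rule vector_space_ga_scale)
  \<comment> \<open>By the last hypothesis \<open>C\<close> is itself a span.\<close>
  have sub: "subspace C"
    by (subst assms(5)) (simp only: schur_code_def subspace_span)
  have schur: "schur f g \<in> C" if "f \<in> C" "g \<in> C" for f g
    by (subst assms(5), unfold schur_code_def, rule span_base) (use that in blast)
  have supp: "f x = 0" if "f \<in> C" "x \<notin> carrier G" for f x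
    using assms(3) that additive_subgroup.a_subset[of C "group_algebra G"]
    unfolding group_code_def right_ideal_def by (auto simp: group_algebra_def)
  have translate: "(\<lambda>x. if x \<in> carrier G then f (x \<otimes>\<^bsub>G\<^esub> g) else 0) \<in> C"
    if "f \<in> C" "g \<in> carrier G" for f g
    using group_code_translate[OF assms(1,2,3)] that .
  have "\<exists>c. c \<in> C \<and> c \<noteq> 0"
    using assms(4) subspace_0[OF sub] by blast
  then obtain c0 where c0: "c0 \<in> C" "c0 \<noteq> 0"
    and c0_min: "\<And>f. f \<in> C \<Longrightarrow> f \<noteq> 0 \<Longrightarrow> wt G c0 \<le> wt G f"
    using ex_has_least_nat[of "\<lambda>c. c \<in> C \<and> c \<noteq> 0" _ "wt G"] by blast
  from c0 obtain g where "c0 g \<noteq> 0" by (auto simp: fun_eq_iff)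
  then have g: "g \<in> carrier G" "c0 g \<noteq> 0" using supp[OF c0(1)] by auto
  \<comment> \<open>The shift moves the support point \<open>g\<close> to the identity.\<close>
  define t where "t x = (if x \<in> carrier G then c0 (x \<otimes>\<^bsub>G\<^esub> g) else 0)" for x
  define c where "c = ga_scale (inverse (c0 g)) t"
  have c: "c \<in> C"
    unfolding c_def t_def using sub translate[OF c0(1) g(1)] by (rule subspace_scale)
  have c1: "c \<one>\<^bsub>G\<^esub> = 1"
    using g by (simp add: c_def t_def ga_scale_def)
  have "wt G c = wt G c0"
    unfolding wt_def
    by (rule bij_betw_same_card[OF bij_betw_byWitness[where f = "\<lambda>x. x \<otimes>\<^bsub>G\<^esub> g" and f' = "\<lambda>x. x \<otimes>\<^bsub>G\<^esub> inv\<^bsub>G\<^esub> g"]])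
       (use g in \<open>auto simp: c_def t_def ga_scale_def m_assoc\<close>)
  with c0_min have c_min: "wt G c \<le> wt G f" if "f \<in> C" "f \<noteq> 0" for f
    using that by simp
  have const: "f x = f \<one>\<^bsub>G\<^esub>" if f: "f \<in> C" and x: "c x \<noteq> 0" for f x
  proof -
    define d where "d = schur f c - ga_scale (f \<one>\<^bsub>G\<^esub>) c"
    have d: "d \<in> C"
      unfolding d_def using sub f c schur by (intro subspace_diff subspace_scale)
    have "{g \<in> carrier G. d g \<noteq> 0} \<subset> {g \<in> carrier G. c g \<noteq> 0}"
    proof
      show "{g \<in> carrier G. d g \<noteq> 0} \<subseteq> {g \<in> carrier G. c g \<noteq> 0}"
        by (auto simp: d_def schur_def ga_scale_def)
      have "\<one>\<^bsub>G\<^esub> \<in> {g \<in> carrier G. c g \<noteq> 0} - {g \<in> carrier G. d g \<noteq> 0}"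
        by (simp add: d_def schur_def ga_scale_def c1)
      then show "{g \<in> carrier G. d g \<noteq> 0} \<noteq> {g \<in> carrier G. c g \<noteq> 0}"
        by blast
    qed
    then have "wt G d < wt G c"
      unfolding wt_def using fin by (intro psubset_card_mono) auto
    with c_min d have "d = 0" by (meson not_le)
    then have "d x = 0" by simp
    \<comment> \<open>The equation reads \<open>f x * c x = f \<one> * c x\<close>, and
      \<open>c x\<close> cancels.\<close>
    with x show ?thesis
      by (simp add: d_def schur_def ga_scale_def)
  qed
  define H where "H = {h \<in> carrier G. \<forall>f\<in>C. \<forall>x\<in>carrier G. f (h \<otimes>\<^bsub>G\<^esub> x) = f x}"
  have H: "subgroup H G"
  proof (rule subgroupI)
    fix h assume h: "h \<in> H"
    then have hG: "h \<in> carrier G" by (simp add: H_def)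
    have "f (inv\<^bsub>G\<^esub> h \<otimes>\<^bsub>G\<^esub> x) = f x" if f: "f \<in> C" and x: "x \<in> carrier G" for f x
    proof -
      have "f (h \<otimes>\<^bsub>G\<^esub> (inv\<^bsub>G\<^esub> h \<otimes>\<^bsub>G\<^esub> x)) = f (inv\<^bsub>G\<^esub> h \<otimes>\<^bsub>G\<^esub> x)"
        using h f x hG unfolding H_def by blast
      then show ?thesis
        using x hG by (simp add: m_assoc[symmetric])
    qed
    with hG show "inv\<^bsub>G\<^esub> h \<in> H" by (simp add: H_def)
  qed (auto simp: H_def m_assoc)
  have memH: "x \<in> H" if x: "c x \<noteq> 0" for x
  proof -
    have "x \<in> carrier G" using supp[OF c] x by blast
    \<comment> \<open>Constancy on the support of \<open>c\<close> is applied to the translate of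
      \<open>f\<close> by \<open>y\<close>, whose values at \<open>x\<close> and at the identity are
      the two sides.\<close>
    moreover have "f (x \<otimes>\<^bsub>G\<^esub> y) = f y" if "f \<in> C" "y \<in> carrier G" for f y
      using const[OF translate[OF that] x] \<open>x \<in> carrier G\<close> that by simp
    ultimately show ?thesis by (simp add: H_def)
  qed
  have c_on_H: "c h = 1" if "h \<in> H" for h
  proof -
    have "h \<in> carrier G" "c (h \<otimes>\<^bsub>G\<^esub> \<one>\<^bsub>G\<^esub>) = c \<one>\<^bsub>G\<^esub>"
      using that c unfolding H_def by blast+
    then show ?thesis using c1 by simp
  qed
  have c_eq: "c = (\<Sum>h\<in>H. ga_elem h)"
  proof
    fix x
    have "finite H" using fin by (simp add: H_def)
    then show "c x = (\<Sum>h\<in>H. ga_elem h) x"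
      using memH c_on_H by (cases "x \<in> H") (auto simp: sum_fun_apply ga_elem_def)
  qed
  have C_eq: "C = induced_trivial G H"
  proof
    show "C \<subseteq> induced_trivial G H"
      unfolding induced_trivial_eq_periodic[OF assms(1,2) H] using supp by (auto simp: H_def)
    show "induced_trivial G H \<subseteq> C"
      \<comment> \<open>The induced module is the right ideal generated by \<open>c\<close>, which
        lies in \<open>C\<close>.\<close>
      using assms(3) c unfolding induced_trivial_def c_eq[symmetric] group_code_def right_ideal_def
      by blast
  qed
  have "{x \<in> carrier G. c x \<noteq> 0} = H"
    using memH c_on_H subgroup.subset[OF H] by auto
  then have "wt G c = card H" by (simp add: wt_def)
  moreover have "min_dist G C = wt G c"
    unfolding min_dist_def
  proof (rule Min_eqI)
    \<comment> \<open>The code may be infinite, but its weights are bounded by the group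
      order.\<close>
    have "{wt G f |f. f \<in> C \<and> f \<noteq> 0} \<subseteq> {..card (carrier G)}"
      using fin by (auto simp: wt_def intro: card_mono)
    then show "finite {wt G f |f. f \<in> C \<and> f \<noteq> 0}" by (rule finite_subset) simp
    have "c \<noteq> 0" using c1 by auto
    then show "wt G c \<in> {wt G f |f. f \<in> C \<and> f \<noteq> 0}" using c by blast
  qed (use c_min in auto)
  \<comment> \<open>Minimum distance is the order of \<open>H\<close> and dimension its index, so
    Lagrange applies.\<close>
  ultimately have "min_dist G C * code_dim C = order G"
    using lagrange[OF H] code_dim_induced_trivial[OF assms(1,2) H, where 'k = 'k]
    by (simp add: C_eq mult.commute)
  with H C_eq show ?thesis by blast
qed

end
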